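(* Let $\mathcal{X}$ be a Banach space with dual $\mathcal{X}^*$ and metric $d(x,y)=\|x-y\|$, let $f\colon\mathcal{X}\to\mathbb{R}\cup\{+\infty\}$ be a closed function, and let $x\in\mathcal{X}$ be a point with $f(x)$ finite. Let $f_x\colon\mathcal{X}\to\mathbb{R}\cup\{+\infty\}$ be a closed function such that $$|f_x(y)-f(y)|\leq\omega_1(d(x,y))\quad\text{for all } y\in\mathcal{X},$$ where $\omega_1$ is some growth function. Suppose moreover that for some point $x^+\in\mathcal{X}$, a dual element $v\in\mathcal{X}^*$, and a growth function $\omega_2$, $$f_x(y)\geq f_x(x^+)+\langle v,y-x^+\rangle-\omega_2(d(y,x^+))\quad\text{for all } y\in\mathcal{X}.$$ Then there exists a point $\hat x\in\mathcal{X}$ satisfying 1. (point proximity) $d(x^+,\hat x)\leq2\cdot\frac{\omega_1(d(x^+,x))}{\omega_1'(d(x^+,x))}$, under the convention $\frac00=0$, 2. (value proximity) $f(\hat x)\leq f(x^+)+\langle v,\hat x-x^+\rangle+\omega_1(d(x^+,x))-\omega_2(d(\hat x,x^+))$, 3. (near-stationarity) $|\nabla f|(\hat x)\leq\|v\|+\omega_1'(d(x^+,x))+\omega_1'(d(\hat x,x))+\omega_2'(d(\hat x,x^+))$.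
   Context: A function is called closed if it is lower-semicontinuous. $\langle v,x\rangle:=v(x)$ for $v\in\mathcal{X}^*$, and $\|v\|$ is the dual norm. A growth function is a differentiable function $\omega\colon[0,\infty)\to[0,\infty)$ (one-sided derivative at $0$) with $\omega(0)=\omega'(0)=0$ and $\omega'>0$ on $(0,\infty)$. The slope of $f$ at a point $\bar x$ with $f(\bar x)$ finite is $|\nabla f|(\bar x):=\limsup_{x\to\bar x,\,x\ne\bar x}\frac{(f(\bar x)-f(x))^+}{d(\bar x,x)}$, where $r^+=\max\{0,r\}$ (it is $0$ if $\bar x$ is isolated); by convention $|\nabla f|(\bar x)=+\infty$ where $f(\bar x)=+\infty$. The inequality $|f_x(y)-f(y)|\le\omega_1(d(x,y))$ is understood to mean that $f_x(y)$ and $f(y)$ are either both $+\infty$ or both finite and satisfying the inequality. *)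

theory Defs
  imports "HOL-Analysis.Analysis"
begin

text \<open>
  Functions with values in the reals extended by \<open>+\<infinity>\<close> are \<open>ereal\<close>-valued functions that
  omit \<open>-\<infinity>\<close>.
\<close>

definition omits_minus_infinity :: "('a \<Rightarrow> ereal) \<Rightarrow> bool" where
  "omits_minus_infinity f \<longleftrightarrow> (\<forall>x. f x \<noteq> -\<infinity>)"

text \<open>
  Lower semicontinuity. At an isolated point the filter \<open>at x\<close> is trivial, the \<open>Liminf\<close> is
  \<open>+\<infinity>\<close>, and the condition holds vacuously.
\<close>

definition closed_function :: "('a::topological_space \<Rightarrow> ereal) \<Rightarrow> bool" where
  "closed_function f \<longleftrightarrow> (\<forall>x. f x \<le> Liminf (at x) f)"

text \<open>
  A growth function lives on \<open>[0,\<infinity>)\<close>; it is represented by a total function whose values at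
  negative arguments are irrelevant. The derivative is taken within \<open>[0,\<infinity>)\<close>, so it is the
  right derivative at \<open>0\<close> and the ordinary derivative at positive arguments.
\<close>

definition deriv_nonneg :: "(real \<Rightarrow> real) \<Rightarrow> real \<Rightarrow> real" where
  "deriv_nonneg \<omega> t = vector_derivative \<omega> (at t within {0..})"

definition growth_function :: "(real \<Rightarrow> real) \<Rightarrow> bool" where
  "growth_function \<omega> \<longleftrightarrow>
     (\<forall>t\<ge>0. \<omega> t \<ge> 0) \<and>
     \<omega> differentiable_on {0..} \<and>
     \<omega> 0 = 0 \<and> deriv_nonneg \<omega> 0 = 0 \<and>
     (\<forall>t>0. deriv_nonneg \<omega> t > 0)"

text \<open>
  The isolated case needs its own branch, since \<open>Limsup\<close> along the trivial filter is \<open>-\<infinity>\<close>.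
\<close>

definition slope :: "('a::metric_space \<Rightarrow> ereal) \<Rightarrow> 'a \<Rightarrow> ereal" where
  "slope f x =
     (if f x = \<infinity> then \<infinity>
      else if at x = bot then 0
      else Limsup (at x) (\<lambda>y. max 0 (f x - f y) / ereal (dist x y)))"

text \<open>
  The inequality \<open>|a - b| \<le> r\<close> for extended values: both are \<open>+\<infinity>\<close>, or both are finite and
  satisfy it. (The bare \<open>ereal\<close> inequality would not express this, as \<open>\<infinity> - \<infinity> = \<infinity>\<close> there.)
\<close>

definition within_error :: "ereal \<Rightarrow> ereal \<Rightarrow> real \<Rightarrow> bool" where
  "within_error a b r \<longleftrightarrow>
     (a = \<infinity> \<and> b = \<infinity>) \<or>
     (\<bar>a\<bar> \<noteq> \<infinity> \<and> \<bar>b\<bar> \<noteq> \<infinity> \<and> \<bar>a - b\<bar> \<le> ereal r)"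

end

theory Submission
  imports Defs
begin

text \<open>
  Put \<open>g y = f y - v (y - xp) + \<omega>1 (dist y x) + \<omega>2 (dist y xp)\<close>. The two hypotheses on the model
  give \<open>g \<ge> fx xp \<ge> g xp - 2 * \<omega>1 (dist xp x)\<close>, so Ekeland's variational principle, with slope
  parameter \<open>\<omega>1' (dist xp x)\<close>, yields a point near \<open>xp\<close> at which the slope of \<open>g\<close> is at most that
  parameter. The slopes of the three terms added to \<open>f\<close> account for the rest of the bound.
\<close>

section \<open>Lower semicontinuity\<close>

lemma closed_function_eventually_gt:
  assumes "closed_function g" "a < g y"
  shows "eventually (\<lambda>z. a < g z) (nhds y)"
  using assms unfolding closed_function_def eventually_nhds_conv_at le_Liminf_iff by auto

text \<open>Reals are dense in the extended line, so every failure of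
  \<open>g y \<le> Liminf (at y) g\<close> is witnessed by a real threshold.\<close>

lemma closed_functionI:
  assumes "\<And>y r. ereal r < g y \<Longrightarrow> eventually (\<lambda>z. ereal r < g z) (at y)"
  shows "closed_function g"
  unfolding closed_function_def
proof
  fix y
  show "g y \<le> Liminf (at y) g"
  proof (rule ccontr)
    assume "\<not> ?thesis"
    then obtain r where r: "Liminf (at y) g < ereal r" "ereal r < g y"
      using ereal_dense2 not_le by metis
    have "ereal r \<le> Liminf (at y) g"
      by (rule Liminf_bounded) (use assms[OF r(2)] in eventually_elim, simp)
    with r(1) show False by simp
  qed
qed

lemma closed_function_add_continuous:
  fixes g :: "'a::topological_space \<Rightarrow> ereal" and h :: "'a \<Rightarrow> real"
  assumes "closed_function g" "continuous_on UNIV h"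
  shows "closed_function (\<lambda>y. g y + ereal (h y))"
proof (rule closed_functionI)
  fix y r
  assume "ereal r < g y + ereal (h y)"
  then have "ereal (r - h y) < g y"
    by (cases "g y") auto
  \<comment> \<open>Splitting the threshold at a real \<open>s\<close> leaves two independent
    demands near \<open>y\<close>: \<open>g\<close> stays above \<open>s\<close>, and
    \<open>h\<close> stays above \<open>r - s\<close>.\<close>
  then obtain s where s: "ereal (r - h y) < ereal s" "ereal s < g y"
    using ereal_dense2 by blast
  have "(h \<longlongrightarrow> h y) (at y)"
    using assms(2) by (simp add: continuous_on_def)
  then have "eventually (\<lambda>z. r - s < h z) (at y)"
    by (rule order_tendstoD) (use s(1) in simp)
  moreover have "eventually (\<lambda>z. ereal s < g z) (at y)"
    using closed_function_eventually_gt[OF assms(1) s(2)] by (simp add: eventually_nhds_conv_at)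
  ultimately show "eventually (\<lambda>z. ereal r < g z + ereal (h z)) (at y)"
  proof eventually_elim
    case (elim z)
    then show ?case by (cases "g z") auto
  qed
qed

lemma closed_sublevel:
  assumes "closed_function g"
  shows "closed {y. g y \<le> c}"
proof -
  have "open {y. c < g y}"
    using closed_function_eventually_gt[OF assms]
    by (subst open_subopen) (fastforce simp: eventually_nhds)
  moreover have "{y. g y \<le> c} = - {y. c < g y}" by auto
  ultimately show ?thesis by (simp add: closed_def)
qed

section \<open>Ekeland's variational principle\<close>

text \<open>\<open>S u\<close> is the lower set of \<open>u\<close> in Ekeland's preorder: the drop
  in value must pay for \<open>l\<close> times the distance. Moving repeatedly to a near-minimizer
  of the current lower set gives nested closed sets with diameters tending to zero. By completeness
  they meet in one point \<open>z\<close>, which is minimal because \<open>S z\<close> lies in all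
  of them.\<close>

lemma ekeland:
  fixes g :: "'a::complete_space \<Rightarrow> ereal" and l :: real
  assumes closed: "closed_function g" and lower: "\<And>y. ereal m \<le> g y"
    and fin: "g x0 \<noteq> \<infinity>" and l: "l > 0"
  obtains z where "g z + ereal (l * dist x0 z) \<le> g x0"
    and "\<And>y. y \<noteq> z \<Longrightarrow> g z < g y + ereal (l * dist z y)"
proof -
  define S where "S = (\<lambda>u. {y. g y + ereal (l * dist u y) \<le> g u})"
  have S_refl: "u \<in> S u" for u
    by (simp add: S_def flip: zero_ereal_def)
  have S_le: "g y \<le> g u" if "y \<in> S u" for u y
    using that l unfolding S_def by (cases "g y"; cases "g u") (auto intro: order_trans[rotated])
  have S_trans: "w \<in> S u" if "y \<in> S u" "w \<in> S y" for u y w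
  proof -
    have "l * dist u w \<le> l * dist u y + l * dist y w"
      using l by (simp add: dist_triangle flip: distrib_left)
    then show ?thesis
      using that unfolding S_def by (cases "g y"; cases "g u"; cases "g w") auto
  qed
  have S_closed: "closed (S u)" for u
    unfolding S_def
    by (intro closed_sublevel closed_function_add_continuous closed continuous_intros)
  have step: "\<exists>y. y \<in> S u \<and> (\<forall>w\<in>S u. g y \<le> g w + ereal ((1/2)^n))" if "g u \<noteq> \<infinity>" for u n
  proof -
    \<comment> \<open>Only a finite infimum becomes strictly larger when a positive tolerance is
      added, which is what produces a near-minimizer.\<close>
    have Inf: "\<bar>INF w\<in>S u. g w\<bar> \<noteq> \<infinity>"
    proof -
      have "ereal m \<le> (INF w\<in>S u. g w)" by (rule INF_greatest) (rule lower)
      moreover have "(INF w\<in>S u. g w) \<le> g u" by (rule INF_lower) (rule S_refl)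
      ultimately show ?thesis using that by auto
    qed
    then have "(INF w\<in>S u. g w) < (INF w\<in>S u. g w) + ereal ((1/2)^n)"
      by (cases "INF w\<in>S u. g w") auto
    then obtain y where "y \<in> S u" "g y < (INF w\<in>S u. g w) + ereal ((1/2)^n)"
      unfolding INF_less_iff by blast
    moreover have "(INF w\<in>S u. g w) + ereal ((1/2)^n) \<le> g w + ereal ((1/2)^n)" if "w \<in> S u" for w
      by (intro add_right_mono INF_lower that)
    ultimately show ?thesis by (meson less_imp_le order_trans)
  qed
  have "\<exists>X. \<forall>n. (g (X n) \<noteq> \<infinity> \<and> X n \<in> S x0) \<and>
      (X (Suc n) \<in> S (X n) \<and> (\<forall>w\<in>S (X n). g (X (Suc n)) \<le> g w + ereal ((1/2)^n)))"
  proof (rule dependent_nat_choice)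
    show "\<exists>u. g u \<noteq> \<infinity> \<and> u \<in> S x0" using fin S_refl by blast
    fix u n
    assume u: "g u \<noteq> \<infinity> \<and> u \<in> S x0"
    with step obtain y where "y \<in> S u" "\<forall>w\<in>S u. g y \<le> g w + ereal ((1/2)^n)" by blast
    with u S_le[of y u] S_trans show "\<exists>y. (g y \<noteq> \<infinity> \<and> y \<in> S x0) \<and>
        (y \<in> S u \<and> (\<forall>w\<in>S u. g y \<le> g w + ereal ((1/2)^n)))"
      by (intro exI[of _ y]) auto
  qed
  then obtain X where X_fin: "\<And>n. g (X n) \<noteq> \<infinity>" and X_S: "\<And>n. X n \<in> S x0"
    and X_Suc: "\<And>n. X (Suc n) \<in> S (X n)"
    and X_inf: "\<And>n w. w \<in> S (X n) \<Longrightarrow> g (X (Suc n)) \<le> g w + ereal ((1/2)^n)"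
    by blast
  have S_anti: "S (X j) \<subseteq> S (X i)" if "i \<le> j" for i j
    using that by (induction rule: dec_induct) (use X_Suc S_trans in blast)+
  \<comment> \<open>By the choice of \<open>X (Suc n)\<close>, no \<open>w\<close> in the larger set
    \<open>S (X n)\<close> lies more than \<open>(1/2)^n\<close> below it in value. Membership in
    \<open>S (X (Suc n))\<close> bounds \<open>l\<close> times the distance by that drop.\<close>
  have close: "l * dist (X (Suc n)) w \<le> (1/2)^n" if "w \<in> S (X (Suc n))" for n w
  proof -
    have "w \<in> S (X n)" using that S_anti[of n "Suc n"] by auto
    from X_inf[OF this] that lower[of w] X_fin[of "Suc n"] show ?thesis
      unfolding S_def by (cases "g w"; cases "g (X (Suc n))") auto
  qed
  have small: "\<exists>n. (1/2)^n < l * e" if "e > 0" for e :: real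
    using real_arch_pow_inv[of "l * e" "1/2"] l that by auto
  obtain z where z: "(\<Inter>n. S (X n)) = {z}"
  proof -
    have "\<exists>z. \<Inter> (range (\<lambda>n. S (X n))) = {z}"
    proof (rule decreasing_closed_nest_sing)
      show "\<exists>n. \<forall>y\<in>S (X n). \<forall>w\<in>S (X n). dist y w < e" if e: "e > 0" for e :: real
      proof -
        obtain n where n: "(1/2)^n < l * (e/2)" using small[of "e/2"] e by auto
        have "dist (X (Suc n)) y < e/2" if "y \<in> S (X (Suc n))" for y
        proof -
          have "l * dist (X (Suc n)) y < l * (e/2)"
            using close[OF that] n by linarith
          then show ?thesis using l by (metis mult_less_cancel_left_pos)
        qed
        then show ?thesis by (metis dist_triangle_half_r)
      qed
    qed (use S_closed S_refl S_anti in blast)+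
    then show ?thesis using that by auto
  qed
  have "z \<in> S x0" using z X_S S_trans by blast
  \<comment> \<open>A competitor violating the strict inequality would lie in \<open>S z\<close>,
    hence in the whole intersection, which is only \<open>z\<close>.\<close>
  moreover have "g z < g y + ereal (l * dist z y)" if "y \<noteq> z" for y
  proof (rule ccontr)
    assume "\<not> ?thesis"
    then have "y \<in> S z" by (simp add: S_def not_less)
    then have "y \<in> (\<Inter>n. S (X n))" using z S_trans by blast
    with z that show False by auto
  qed
  ultimately show ?thesis using that unfolding S_def by auto
qed

section \<open>Slopes\<close>

text \<open>Multiplying out the difference quotient makes infinite values of \<open>f y\<close>
  harmless. The slack \<open>e\<close> is removed at the end, and \<open>M \<ge> 0\<close> also
  covers an isolated point, where the slope is \<open>0\<close>.\<close>

lemma slope_le: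
  assumes fin: "\<bar>f x\<bar> \<noteq> \<infinity>" and "M \<ge> 0"
    and bd: "\<And>e. e > 0 \<Longrightarrow> eventually (\<lambda>y. f x \<le> f y + ereal ((M + e) * dist x y)) (at x)"
  shows "slope f x \<le> ereal M"
proof (rule ereal_le_epsilon2)
  fix e :: real
  assume e: "e > 0"
  have "Limsup (at x) (\<lambda>y. max 0 (f x - f y) / ereal (dist x y)) \<le> ereal (M + e)"
  proof (rule Limsup_bounded)
    have "eventually (\<lambda>y. y \<noteq> x) (at x)" by (simp add: eventually_at_filter)
    with bd[OF e]
    show "eventually (\<lambda>y. max 0 (f x - f y) / ereal (dist x y) \<le> ereal (M + e)) (at x)"
    proof eventually_elim
      case (elim y)
      have d: "dist x y > 0" using elim by auto
      have "max 0 (f x - f y) \<le> ereal (M + e) * ereal (dist x y)"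
        using elim fin \<open>M \<ge> 0\<close> e by (cases "f x"; cases "f y") auto
      then show ?case using d by (simp add: ereal_divide_le_pos mult.commute)
    qed
  qed
  then show "slope f x \<le> ereal M + ereal e"
    using fin \<open>M \<ge> 0\<close> e by (auto simp: slope_def)
qed

section \<open>Growth functions and their composition with a distance\<close>

lemma growth_function_nonneg: "growth_function \<omega> \<Longrightarrow> t \<ge> 0 \<Longrightarrow> \<omega> t \<ge> 0"
  by (simp add: growth_function_def)

lemma growth_function_deriv_nonneg: "growth_function \<omega> \<Longrightarrow> t \<ge> 0 \<Longrightarrow> deriv_nonneg \<omega> t \<ge> 0"
  by (cases "t = 0") (auto simp: growth_function_def less_imp_le)

lemma growth_function_has_derivative:
  assumes "growth_function \<omega>" "t \<ge> 0"
  shows "(\<omega> has_derivative (\<lambda>s. s * deriv_nonneg \<omega> t)) (at t within {0..})"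
  using assms
  by (auto simp: growth_function_def deriv_nonneg_def differentiable_on_def
      vector_derivative_works has_vector_derivative_def)

lemma growth_function_dist_continuous:
  assumes "growth_function \<omega>"
  shows "continuous_on UNIV (\<lambda>y. \<omega> (dist y z))"
proof -
  have "continuous_on {0..} \<omega>"
    using assms by (simp add: growth_function_def differentiable_imp_continuous_on)
  then show ?thesis
    by (rule continuous_on_compose2) (auto intro: continuous_intros)
qed

text \<open>First-order expansion of \<open>\<omega>\<close> at \<open>dist u z\<close>, combined
  with the 1-Lipschitz property of the distance. Distances are nonnegative, so the derivative within
  \<open>{0..}\<close> suffices even at \<open>0\<close>; its nonnegativity lets
  \<open>dist u y\<close> replace the signed increment.\<close>

lemma growth_function_dist_upper:
  fixes u z :: "'a::metric_space"
  assumes "growth_function \<omega>" "e > 0"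
  shows "eventually (\<lambda>y. \<omega> (dist y z) - \<omega> (dist u z) \<le> (deriv_nonneg \<omega> (dist u z) + e) * dist u y)
    (at u)"
proof -
  let ?t = "dist u z" let ?D = "deriv_nonneg \<omega> (dist u z)"
  obtain d where d: "d > 0" and lin: "\<And>s. s \<ge> 0 \<Longrightarrow> \<bar>s - ?t\<bar> < d \<Longrightarrow>
      \<bar>\<omega> s - \<omega> ?t - (s - ?t) * ?D\<bar> \<le> e * \<bar>s - ?t\<bar>"
    using growth_function_has_derivative[OF assms(1), of ?t] assms(2)
    unfolding has_derivative_within_alt by force
  have D: "?D \<ge> 0" using growth_function_deriv_nonneg[OF assms(1)] by simp
  have "eventually (\<lambda>y. dist y u < d) (at u)"
    using d by (auto simp: eventually_at)
  then show ?thesis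
  proof eventually_elim
    case (elim y)
    have t: "\<bar>dist y z - ?t\<bar> \<le> dist u y"
      by (smt (verit) dist_commute dist_triangle)
    then have "\<omega> (dist y z) - \<omega> ?t \<le> (dist y z - ?t) * ?D + e * \<bar>dist y z - ?t\<bar>"
      using lin[of "dist y z"] elim dist_commute[of y u] by fastforce
    also have "\<dots> \<le> dist u y * ?D + e * dist u y"
      using t D assms(2) by (intro add_mono mult_right_mono mult_left_mono) auto
    finally show ?case by (simp add: algebra_simps)
  qed
qed

section \<open>Ekeland's principle applied to the perturbed function\<close>

theorem corollary5p9:
  fixes f fx :: "'a::banach \<Rightarrow> ereal"
    and x xp :: 'a
    and v :: "'a \<Rightarrow>\<^sub>L real"
    and \<omega>1 \<omega>2 :: "real \<Rightarrow> real"
  assumes "omits_minus_infinity f" and "closed_function f"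
    and "f x \<noteq> \<infinity>"
    and "omits_minus_infinity fx" and "closed_function fx"
    and "growth_function \<omega>1"
    and "\<forall>y. within_error (fx y) (f y) (\<omega>1 (dist x y))"
    and "growth_function \<omega>2"
    and "\<forall>y. fx y \<ge> fx xp + ereal (blinfun_apply v (y - xp)) - ereal (\<omega>2 (dist y xp))"
  shows "\<exists>xh.
      dist xp xh \<le> 2 * (\<omega>1 (dist xp x) / deriv_nonneg \<omega>1 (dist xp x)) \<and>
      f xh \<le> f xp + ereal (blinfun_apply v (xh - xp)) + ereal (\<omega>1 (dist xp x))
               - ereal (\<omega>2 (dist xh xp)) \<and>
      slope f xh \<le> ereal (norm v + deriv_nonneg \<omega>1 (dist xp x) + deriv_nonneg \<omega>1 (dist xh x)
                            + deriv_nonneg \<omega>2 (dist xh xp))"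
proof -
  note growth = assms(6) assms(8)
  have err: "within_error (fx y) (f y) (\<omega>1 (dist y x))" for y
    using assms(7) by (metis dist_commute)
  have model: "fx xp + ereal (v (y - xp)) - ereal (\<omega>2 (dist y xp)) \<le> fx y" for y
    using assms(9) by blast
  have "fx x \<noteq> \<infinity>" using err[of x] assms(3) by (auto simp: within_error_def)
  \<comment> \<open>An infinite \<open>fx xp\<close> would make the lower model infinite everywhere,
    in particular at \<open>x\<close>.\<close>
  with model[of x] have "fx xp \<noteq> \<infinity>" by auto
  then obtain m where m: "fx xp = ereal m"
    using assms(4) by (cases "fx xp") (auto simp: omits_minus_infinity_def)
  obtain a where a: "f xp = ereal a"
    using err[of xp] m by (cases "f xp") (auto simp: within_error_def)
  define \<phi> where "\<phi> y = \<omega>1 (dist y x) + \<omega>2 (dist y xp) - v (y - xp)" for y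
  define g where "g y = f y + ereal (\<phi> y)" for y
  have w2: "\<omega>2 0 = 0" using assms(8) by (simp add: growth_function_def)
  have g_closed: "closed_function g"
    unfolding g_def \<phi>_def
    by (intro closed_function_add_continuous assms(2) continuous_intros
        growth_function_dist_continuous growth)
  \<comment> \<open>One half of the error bound,
    \<open>fx y \<le> f y + \<omega>1 (dist y x)\<close>, turns the lower model of \<open>fx\<close>
    into a constant lower bound for \<open>g\<close>.\<close>
  have g_lower: "ereal m \<le> g y" for y
    using err[of y] model[of y] m unfolding g_def \<phi>_def within_error_def
    by (cases "f y"; cases "fx y") auto
  have g_xp: "g xp = ereal (a + \<omega>1 (dist xp x))"
    by (simp add: g_def \<phi>_def a w2 blinfun.zero_right)
  \<comment> \<open>The other half of the error bound, taken at \<open>xp\<close>: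
    \<open>g xp\<close> exceeds the lower bound \<open>m\<close> by at most
    \<open>2 * \<omega>1 (dist xp x)\<close>, the source of the factor 2.\<close>
  have gap: "a + \<omega>1 (dist xp x) \<le> m + 2 * \<omega>1 (dist xp x)"
    using err[of xp] m a by (auto simp: within_error_def)
  let ?l = "deriv_nonneg \<omega>1 (dist xp x)"
  have l_nonneg: "?l \<ge> 0" using growth_function_deriv_nonneg[OF assms(6)] by simp
  have "\<exists>z. dist xp z \<le> 2 * (\<omega>1 (dist xp x) / ?l) \<and> g z \<le> g xp \<and>
      (\<forall>y. g z \<le> g y + ereal (?l * dist z y))"
  \<comment> \<open>If the growth term vanishes, so does the gap, and \<open>xp\<close> itself
    minimizes \<open>g\<close>. This covers \<open>xp = x\<close>, where the slope parameter is
    \<open>0\<close> and the radius is \<open>0/0 = 0\<close>. Otherwise the parameter is positive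
    and Ekeland's principle applies.\<close>
  proof (cases "\<omega>1 (dist xp x) = 0")
    case True
    have "g xp \<le> g y + ereal (?l * dist xp y)" for y
    proof -
      have "g xp \<le> g y" using gap True g_lower[of y] g_xp by (cases "g y") auto
      also have "\<dots> \<le> g y + ereal (?l * dist xp y)"
        using l_nonneg by (cases "g y") auto
      finally show ?thesis .
    qed
    with True show ?thesis by auto
  next
    case False
    then have "dist xp x > 0"
      using assms(6) by (cases "dist xp x = 0") (auto simp: growth_function_def)
    then have l: "?l > 0" using assms(6) by (simp add: growth_function_def)
    obtain z where z: "g z + ereal (?l * dist xp z) \<le> g xp"
      "\<And>y. y \<noteq> z \<Longrightarrow> g z < g y + ereal (?l * dist z y)"
      using ekeland[OF g_closed g_lower _ l, of xp] g_xp by auto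
    have "?l * dist xp z \<le> 2 * \<omega>1 (dist xp x)"
      using z(1) g_xp gap g_lower[of z] by (cases "g z") auto
    then have "dist xp z \<le> 2 * (\<omega>1 (dist xp x) / ?l)"
      using l by (simp add: field_simps)
    moreover have "g z \<le> g xp"
    proof -
      have "?l * dist xp z \<ge> 0" using l by simp
      then show ?thesis using z(1) g_xp by (cases "g z") auto
    qed
    moreover have "g z \<le> g y + ereal (?l * dist z y)" for y
      using z(2)[of y] by (cases "y = z") (auto intro: less_imp_le simp flip: zero_ereal_def)
    ultimately show ?thesis by blast
  qed
  then obtain z where near: "dist xp z \<le> 2 * (\<omega>1 (dist xp x) / ?l)"
    and g_le: "g z \<le> g xp" and ek: "\<And>y. g z \<le> g y + ereal (?l * dist z y)"
    by blast
  obtain b where b: "f z = ereal b"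
    using g_le g_xp assms(1) unfolding g_def
    by (cases "f z") (auto simp: omits_minus_infinity_def)
  \<comment> \<open>This is \<open>g z \<le> g xp\<close> with the nonnegative term
    \<open>\<omega>1 (dist z x)\<close> dropped.\<close>
  have "f z \<le> f xp + ereal (v (z - xp)) + ereal (\<omega>1 (dist xp x)) - ereal (\<omega>2 (dist z xp))"
    using g_le g_xp growth_function_nonneg[OF assms(6), of "dist z x"]
    by (simp add: a b g_def \<phi>_def)
  moreover have "slope f z \<le> ereal (norm v + ?l + deriv_nonneg \<omega>1 (dist z x)
      + deriv_nonneg \<omega>2 (dist z xp))" (is "_ \<le> ereal ?M")
  proof (rule slope_le)
    show "\<bar>f z\<bar> \<noteq> \<infinity>" using b by simp
    show "0 \<le> ?M"
      using l_nonneg growth_function_deriv_nonneg[OF assms(6), of "dist z x"]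
        growth_function_deriv_nonneg[OF assms(8), of "dist z xp"] by simp
    fix e :: real
    assume "e > 0"
    \<comment> \<open>Each of the two growth terms consumes half of the slack; the bounds for
      \<open>v\<close> and for the Ekeland term need none.\<close>
    then have "e/2 > 0" by simp
    from growth_function_dist_upper[OF assms(6) this, of x z]
      growth_function_dist_upper[OF assms(8) this, of xp z]
    show "eventually (\<lambda>y. f z \<le> f y + ereal ((?M + e) * dist z y)) (at z)"
    proof eventually_elim
      case (elim y)
      have "v (z - xp) - v (y - xp) = v (z - y)"
        by (simp add: blinfun.diff_right)
      also have "\<dots> \<le> norm v * dist z y"
        using norm_blinfun[of v "z - y"] by (simp add: dist_norm)
      finally have "\<phi> y - \<phi> z + ?l * dist z y \<le> (?M + e) * dist z y"
        using elim unfolding \<phi>_def by (simp add: algebra_simps)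
      with ek[of y] show ?case
        unfolding g_def b by (cases "f y") auto
    qed
  qed
  ultimately show ?thesis using near by blast
qed

end
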